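(* Let $G$ be a finite simple graph on $n$ vertices and $m$ edges, with maximum vertex degree $\Delta$ and minimum vertex degree $\delta>0$, and let $\overline{m}=|E(\overline{G})|$. Then $$\sqrt{\overline{m}\,\overline{F}(G)}\leq \frac{1}{2}\left(\frac{\delta}{\Delta}+\frac{\Delta}{\delta}\right)\overline{SO}(G).$$
   Context: All graphs are finite and simple, with nonempty vertex set. $d_G(u)$ denotes the degree of $u$ in $G$, and $\overline{G}$ is the complement of $G$; $\overline{m}=|E(\overline{G})|=\binom{n}{2}-m$. The Sombor coindex and the forgotten coindex of $G$ are $$\overline{SO}(G)=\sum_{uv\in E(\overline{G})}\sqrt{d_G(u)^2+d_G(v)^2},\qquad \overline{F}(G)=\sum_{uv\in E(\overline{G})}[d_G(u)^2+d_G(v)^2],$$ the sums being over unordered pairs of distinct non-adjacent vertices of $G$, with degrees taken in $G$. *)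

theory Defs
  imports Complex_Main
begin

locale simple_graph =
  fixes V :: "'a set" and E :: "'a set set"
  assumes finite_V: "finite V"
    and V_nonempty: "V \<noteq> {}"
    and edges_are_pairs: "E \<subseteq> {e. e \<subseteq> V \<and> card e = 2}"

definition vdegree :: "'a set set \<Rightarrow> 'a \<Rightarrow> nat" where
  "vdegree E u = card {v. {u, v} \<in> E}"

definition max_degree :: "'a set \<Rightarrow> 'a set set \<Rightarrow> nat" where
  "max_degree V E = Max (vdegree E ` V)"

definition min_degree :: "'a set \<Rightarrow> 'a set set \<Rightarrow> nat" where
  "min_degree V E = Min (vdegree E ` V)"

definition complement_edges :: "'a set \<Rightarrow> 'a set set \<Rightarrow> 'a set set" where
  "complement_edges V E = {e. e \<subseteq> V \<and> card e = 2} - E"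

(* In both coindices the inner sum over the two endpoints of e = {u, v} is d(u)^2 + d(v)^2;
   degrees are taken in the graph itself, not in its complement. *)

definition sombor_coindex :: "'a set \<Rightarrow> 'a set set \<Rightarrow> real" where
  "sombor_coindex V E =
     (\<Sum>e\<in>complement_edges V E. sqrt (\<Sum>u\<in>e. (real (vdegree E u))\<^sup>2))"

definition forgotten_coindex :: "'a set \<Rightarrow> 'a set set \<Rightarrow> real" where
  "forgotten_coindex V E =
     (\<Sum>e\<in>complement_edges V E. \<Sum>u\<in>e. (real (vdegree E u))\<^sup>2)"

lemma (in simple_graph) card_complement_edges:
  "card (complement_edges V E) = (card V choose 2) - card E"
proof -
  have "finite E"
    using finite_subset[OF edges_are_pairs] finite_V by simp
  then show ?thesis
    unfolding complement_edges_def
    using card_Diff_subset[OF _ edges_are_pairs] n_subsets[OF finite_V, of 2] by simp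
qed

end

theory Submission
  imports Defs
begin

text \<open>
  The claim is a reverse Cauchy--Schwarz inequality. Write \<open>x e\<close> for the term
  \<open>sqrt (d u ^ 2 + d v ^ 2)\<close> of the Sombor coindex at a non-edge \<open>e = uv\<close>; then the forgotten
  coindex is the sum of the squares of the \<open>x e\<close>, and every \<open>x e\<close> lies between
  \<open>sqrt 2 * \<delta>\<close> and \<open>sqrt 2 * \<Delta>\<close>. For numbers confined to \<open>[a, b]\<close>, summing
  \<open>(x - a) * (b - x) \<ge> 0\<close> bounds the sum of squares linearly by the sum, and the inequality of
  arithmetic and geometric means turns this into the bound of \<open>sqrt_card_sum_squares_le\<close>, with
  constant \<open>(a + b) / (2 * sqrt (a * b))\<close>.

  The tight interval would give the sharper constant
  \<open>(sqrt (\<delta> / \<Delta>) + sqrt (\<Delta> / \<delta>)) / 2\<close>. Lowering its left end to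
  \<open>a = sqrt 2 * \<delta>^2 / \<Delta>\<close> makes \<open>a / b = (\<delta> / \<Delta>)^2\<close> and produces exactly
  the constant of the theorem.
\<close>

text \<open>
  After summing \<open>(x - a) * (b - x) \<ge> 0\<close>, the numbers \<open>p = \<Sum> x^2\<close> and
  \<open>q = card I * a * b\<close> satisfy \<open>p + q \<le> (a + b) * \<Sum> x\<close>, while
  \<open>2 * sqrt (p * q) \<le> p + q\<close>.
\<close>

lemma sqrt_card_sum_squares_le:
  fixes x :: "'i \<Rightarrow> real"
  assumes a: "0 < a" and b: "0 < b"
    and bounds: "\<And>i. i \<in> I \<Longrightarrow> a \<le> x i \<and> x i \<le> b"
  shows "sqrt (real (card I) * (\<Sum>i\<in>I. (x i)\<^sup>2))
    \<le> (a + b) / (2 * sqrt (a * b)) * (\<Sum>i\<in>I. x i)"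
proof -
  let ?p = "\<Sum>i\<in>I. (x i)\<^sup>2" and ?q = "real (card I) * (a * b)"
  have "0 \<le> (\<Sum>i\<in>I. (x i - a) * (b - x i))"
    using bounds by (intro sum_nonneg mult_nonneg_nonneg) auto
  also have "\<dots> = (\<Sum>i\<in>I. (a + b) * x i - (x i)\<^sup>2 - a * b)"
    by (intro sum.cong) (auto simp: algebra_simps power2_eq_square)
  also have "\<dots> = (a + b) * (\<Sum>i\<in>I. x i) - ?p - ?q"
    by (simp add: sum_subtractf sum_distrib_left)
  finally have linear: "?p + ?q \<le> (a + b) * (\<Sum>i\<in>I. x i)"
    by simp
  have "sqrt (real (card I) * ?p) * sqrt (a * b) = sqrt (?p * ?q)"
    by (simp add: real_sqrt_mult mult_ac)
  also have "\<dots> \<le> (?p + ?q) / 2"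
    using a b by (intro arith_geo_mean_sqrt sum_nonneg) auto
  also have "\<dots> \<le> (a + b) * (\<Sum>i\<in>I. x i) / 2"
    using linear by (rule divide_right_mono) simp
  finally have "sqrt (real (card I) * ?p) * sqrt (a * b) \<le> (a + b) * (\<Sum>i\<in>I. x i) / 2" .
  then show ?thesis
    using a b by (simp add: field_simps)
qed

lemma (in simple_graph) vdegree_bounds:
  assumes "u \<in> V"
  shows "min_degree V E \<le> vdegree E u" and "vdegree E u \<le> max_degree V E"
  using assms finite_V by (simp_all add: min_degree_def max_degree_def)

lemma (in simple_graph) sombor_term_bounds:
  assumes "e \<in> complement_edges V E"
  shows "sqrt 2 * min_degree V E \<le> sqrt (\<Sum>u\<in>e. (real (vdegree E u))\<^sup>2)"
    and "sqrt (\<Sum>u\<in>e. (real (vdegree E u))\<^sup>2) \<le> sqrt 2 * max_degree V E"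
proof -
  from assms have e: "e \<subseteq> V" "card e = 2"
    by (auto simp: complement_edges_def)
  have "real (card e) * (real (min_degree V E))\<^sup>2 \<le> (\<Sum>u\<in>e. (real (vdegree E u))\<^sup>2)"
    using e vdegree_bounds by (intro sum_bounded_below power_mono) auto
  then show "sqrt 2 * min_degree V E \<le> sqrt (\<Sum>u\<in>e. (real (vdegree E u))\<^sup>2)"
    using e by (intro real_le_rsqrt) (simp add: power_mult_distrib)
  have "(\<Sum>u\<in>e. (real (vdegree E u))\<^sup>2) \<le> real (card e) * (real (max_degree V E))\<^sup>2"
    using e vdegree_bounds by (intro sum_bounded_above power_mono) auto
  then show "sqrt (\<Sum>u\<in>e. (real (vdegree E u))\<^sup>2) \<le> sqrt 2 * max_degree V E"
    using e by (intro real_le_lsqrt) (simp_all add: power_mult_distrib sum_nonneg)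
qed

theorem theorem4p3:
  fixes V :: "'a set" and E :: "'a set set"
    and n m \<Delta> \<delta> mbar :: nat
  assumes "simple_graph V E"
    and "card V = n" and "card E = m"
    and "\<Delta> = max_degree V E"
    and "\<delta> = min_degree V E" and "\<delta> > 0"
    and "mbar = card (complement_edges V E)"
  shows "sqrt (real mbar * forgotten_coindex V E)
    \<le> 1 / 2 * (real \<delta> / real \<Delta> + real \<Delta> / real \<delta>) * sombor_coindex V E"
proof -
  interpret simple_graph V E by fact
  let ?x = "\<lambda>e. sqrt (\<Sum>u\<in>e. (real (vdegree E u))\<^sup>2)"
  let ?a = "sqrt 2 * ((real \<delta>)\<^sup>2 / real \<Delta>)" and ?b = "sqrt 2 * real \<Delta>"
  have "\<delta> \<le> \<Delta>"
    using V_nonempty vdegree_bounds assms by (meson equals0I le_trans)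
  with \<open>\<delta> > 0\<close> have "\<Delta> > 0" and "(real \<delta>)\<^sup>2 / real \<Delta> \<le> real \<delta>"
    by (simp_all add: power2_eq_square divide_le_eq mult_left_mono)
  then have "?a \<le> sqrt 2 * real \<delta>"
    by (intro mult_left_mono) auto
  then have bounds: "?a \<le> ?x e \<and> ?x e \<le> ?b" if "e \<in> complement_edges V E" for e
    using sombor_term_bounds[OF that] assms by auto
  have "?a * ?b = (sqrt 2 * real \<delta>)\<^sup>2"
    using \<open>\<Delta> > 0\<close> by (simp add: power2_eq_square)
  then have "sqrt (?a * ?b) = sqrt 2 * real \<delta>"
    by simp
  then have "(?a + ?b) / (2 * sqrt (?a * ?b))
      = (sqrt 2 * ((real \<delta>)\<^sup>2 / real \<Delta> + real \<Delta>)) / (sqrt 2 * (2 * real \<delta>))"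
    by (simp add: algebra_simps)
  also have "\<dots> = ((real \<delta>)\<^sup>2 / real \<Delta> + real \<Delta>) / (2 * real \<delta>)"
    by (rule mult_divide_mult_cancel_left) simp
  also have "\<dots> = 1 / 2 * (real \<delta> / real \<Delta> + real \<Delta> / real \<delta>)"
    using \<open>\<delta> > 0\<close> \<open>\<Delta> > 0\<close> by (simp add: field_simps power2_eq_square)
  finally have const: "(?a + ?b) / (2 * sqrt (?a * ?b))
      = 1 / 2 * (real \<delta> / real \<Delta> + real \<Delta> / real \<delta>)" .
  have "forgotten_coindex V E = (\<Sum>e\<in>complement_edges V E. (?x e)\<^sup>2)"
    by (simp add: forgotten_coindex_def sum_nonneg)
  moreover have "sqrt (real (card (complement_edges V E)) * (\<Sum>e\<in>complement_edges V E. (?x e)\<^sup>2))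
      \<le> (?a + ?b) / (2 * sqrt (?a * ?b)) * (\<Sum>e\<in>complement_edges V E. ?x e)"
    using \<open>\<delta> > 0\<close> \<open>\<Delta> > 0\<close> bounds by (intro sqrt_card_sum_squares_le) auto
  ultimately show ?thesis
    unfolding const sombor_coindex_def using assms by simp
qed

end
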